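(* Let $n\ge2$ and let $N>0$. Among all $\bm r\in\overline{\mathcal C}=\{\bm r\in\mathbb R^n:r_1\ge\cdots\ge r_n\ge0\}$ with $\sum_{j=1}^n\sinh^2 r_j=N$, the worst passive Fisher weight $w(\bm r)$ has a unique maximizer, and it is the arithmetic progression $$r_j=a+(n-j)b,\qquad j=1,\dots,n,$$ with $a,b>0$ satisfying the balance condition $$2\sinh^2(2a)=4\sinh^2 b=w,$$ where $w$ is the maximal value of $w(\bm r)$. Equivalently, for any prescribed worst weight $w_0>0$, the arithmetic progression $r_j=a+(n-j)b$ with $a,b>0$ and $2\sinh^2(2a)=4\sinh^2b=w_0$ is the unique minimizer of the mean photon number $\sum_{j=1}^n\sinh^2r_j$ among $\bm r\in\overline{\mathcal C}$ with $w(\bm r)\ge w_0$. All other maximizers of $w$ at fixed $N$ on the full space $\mathbb R^n$ are related to this one by mode permutations and squeezing-sign changes, i.e. by permutations and sign changes of the coordinates.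
   Context: $\Sigma_+=\{2\bm e_j\}_{j=1}^n\cup\{\bm e_j-\bm e_k,\ \bm e_j+\bm e_k\}_{1\le j<k\le n}$ with $\bm e_j(\bm r)=r_j$. The passive Fisher weights are $F_{\bm\alpha}(\bm r)=c_{\bm\alpha}\sinh^2[\bm\alpha(\bm r)]$ with $c_{2\bm e_j}=2$ and $c_{\bm e_j\pm\bm e_k}=4$ (these are the eigenvalues of the passive quantum Fisher matrix of the $n$-mode squeezed vacuum with squeezing parameters $\bm r$ in the canonical angle normalization). The worst passive Fisher weight is $w(\bm r)=\min_{\bm\alpha\in\Sigma_+}F_{\bm\alpha}(\bm r)$. The mean photon number is $N(\bm r)=\sum_{j=1}^n\sinh^2r_j$. *)

theory Defs
  imports Complex_Main "HOL-Library.FuncSet" "HOL-Combinatorics.Permutations"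
begin

text \<open>Vectors of \<open>\<real>\<^sup>n\<close> are functions on the index set \<open>{1..n}\<close>, made extensional
  so that equality of functions is equality of vectors.\<close>

abbreviation vecs :: "nat \<Rightarrow> (nat \<Rightarrow> real) set"
  where "vecs n \<equiv> {1..n} \<rightarrow>\<^sub>E UNIV"

definition coord :: "nat \<Rightarrow> (nat \<Rightarrow> real) \<Rightarrow> real"
  where "coord j r = r j"

text \<open>Roots are linear functionals of the squeezing vector.\<close>

definition long_roots :: "nat \<Rightarrow> ((nat \<Rightarrow> real) \<Rightarrow> real) set"
  where "long_roots n = {\<lambda>r. 2 * coord j r | j. 1 \<le> j \<and> j \<le> n}"

definition pos_roots :: "nat \<Rightarrow> ((nat \<Rightarrow> real) \<Rightarrow> real) set"
  where "pos_roots n = long_roots n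
      \<union> {\<lambda>r. coord j r - coord k r | j k. 1 \<le> j \<and> j < k \<and> k \<le> n}
      \<union> {\<lambda>r. coord j r + coord k r | j k. 1 \<le> j \<and> j < k \<and> k \<le> n}"

definition root_coeff :: "nat \<Rightarrow> ((nat \<Rightarrow> real) \<Rightarrow> real) \<Rightarrow> real"
  where "root_coeff n \<alpha> = (if \<alpha> \<in> long_roots n then 2 else 4)"

definition fisher_weight :: "nat \<Rightarrow> ((nat \<Rightarrow> real) \<Rightarrow> real) \<Rightarrow> (nat \<Rightarrow> real) \<Rightarrow> real"
  where "fisher_weight n \<alpha> r = root_coeff n \<alpha> * (sinh (\<alpha> r))\<^sup>2"

definition worst_weight :: "nat \<Rightarrow> (nat \<Rightarrow> real) \<Rightarrow> real"
  where "worst_weight n r = Min ((\<lambda>\<alpha>. fisher_weight n \<alpha> r) ` pos_roots n)"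

definition photon_number :: "nat \<Rightarrow> (nat \<Rightarrow> real) \<Rightarrow> real"
  where "photon_number n r = (\<Sum>j=1..n. (sinh (r j))\<^sup>2)"

definition chamber :: "nat \<Rightarrow> (nat \<Rightarrow> real) set"
  where "chamber n = {r \<in> vecs n.
      (\<forall>j k. 1 \<le> j \<and> j \<le> k \<and> k \<le> n \<longrightarrow> r j \<ge> r k) \<and> (\<forall>j\<in>{1..n}. r j \<ge> 0)}"

definition arith_prog :: "nat \<Rightarrow> real \<Rightarrow> real \<Rightarrow> (nat \<Rightarrow> real)"
  where "arith_prog n a b = (\<lambda>j\<in>{1..n}. a + real (n - j) * b)"

lemma finite_pos_roots: "finite (pos_roots n)"
proof -
  have "pos_roots n \<subseteq> (\<lambda>j r. 2 * coord j r) ` {1..n}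
      \<union> (\<lambda>(j, k) r. coord j r - coord k r) ` ({1..n} \<times> {1..n})
      \<union> (\<lambda>(j, k) r. coord j r + coord k r) ` ({1..n} \<times> {1..n})"
    unfolding pos_roots_def long_roots_def by (fastforce simp: image_iff)
  then show ?thesis
    by (rule finite_subset) simp
qed

lemma root_coeff_long:
  "1 \<le> j \<Longrightarrow> j \<le> n \<Longrightarrow> root_coeff n (\<lambda>r. 2 * coord j r) = 2"
  unfolding root_coeff_def long_roots_def by auto

lemma root_coeff_diff: "root_coeff n (\<lambda>r. coord j r - coord k r) = 4"
proof -
  have "(\<lambda>r. coord j r - coord k r) \<noteq> (\<lambda>r. 2 * coord i r)" for i
    by (auto simp: coord_def fun_eq_iff intro!: exI[of _ "\<lambda>_. 1"])
  then show ?thesis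
    unfolding root_coeff_def long_roots_def by auto
qed

lemma root_coeff_sum:
  assumes "j \<noteq> k"
  shows "root_coeff n (\<lambda>r. coord j r + coord k r) = 4"
proof -
  have "(\<lambda>r. coord j r + coord k r) \<noteq> (\<lambda>r. 2 * coord i r)" for i
    using assms
    by (auto simp: coord_def fun_eq_iff split: if_splits intro!: exI[of _ "\<lambda>i. if i = j then 1 else 0"])
  then show ?thesis
    unfolding root_coeff_def long_roots_def by auto
qed

end

(* On the chamber, worst weight at least w means r_n \<ge> a and r_j - r_(j+1) \<ge> b for the balanced
   pair a, b belonging to w, so every feasible vector dominates the arithmetic progression
   coordinatewise; hence the progression alone minimizes the photon number. The photon number of
   the balanced progression varies continuously with a from 0 to infinity, so each N is attained,
   and domination turns into maximality of the worst weight at fixed N. Sorting the absolute values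
   of the coordinates reduces the full space to the chamber. *)

theory Submission
  imports Defs
begin

section \<open>Worst weight as a system of inequalities\<close>

text \<open>\<open>sinh\<close> is odd and strictly increasing, so squaring it forgets only the
  sign. Every comparison of Fisher weights below becomes a comparison of absolute values.\<close>

lemma sinh_sq_le_iff: "(sinh x)\<^sup>2 \<le> (sinh y)\<^sup>2 \<longleftrightarrow> \<bar>x\<bar> \<le> \<bar>y\<bar>" for x y :: real
  by (simp add: abs_le_square_iff[symmetric] flip: sinh_real_abs)

lemma sinh_sq_eq_iff: "(sinh x)\<^sup>2 = (sinh y)\<^sup>2 \<longleftrightarrow> \<bar>x\<bar> = \<bar>y\<bar>" for x y :: real
  by (simp add: order_eq_iff sinh_sq_le_iff)

lemma sinh_abs_sq: "(sinh \<bar>x\<bar>)\<^sup>2 = (sinh x)\<^sup>2" for x :: real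
  by (simp add: sinh_sq_eq_iff)

text \<open>Translates the minimum over functionals into inequalities on coordinates; later
  arguments no longer touch the roots themselves. Ranging over all pairs with
  \<open>j \<noteq> k\<close>, not just \<open>j < k\<close>, makes the condition visibly symmetric
  under permutations of the indices.\<close>

lemma worst_weight_ge_iff:
  assumes "n \<ge> 1"
  shows "w \<le> worst_weight n r \<longleftrightarrow>
    (\<forall>j\<in>{1..n}. w \<le> 2 * (sinh (2 * r j))\<^sup>2) \<and>
    (\<forall>j\<in>{1..n}. \<forall>k\<in>{1..n}. j \<noteq> k \<longrightarrow>
      w \<le> 4 * (sinh (r j - r k))\<^sup>2 \<and> w \<le> 4 * (sinh (r j + r k))\<^sup>2)"
    (is "_ \<longleftrightarrow> ?L \<and> ?S")
proof -
  have "(\<lambda>r. 2 * coord 1 r) \<in> pos_roots n"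
    using assms by (auto simp: pos_roots_def long_roots_def)
  then have "pos_roots n \<noteq> {}"
    by blast
  then have ge: "w \<le> worst_weight n r \<longleftrightarrow> (\<forall>\<alpha>\<in>pos_roots n. w \<le> fisher_weight n \<alpha> r)"
    unfolding worst_weight_def by (subst Min_ge_iff) (auto simp: finite_pos_roots)
  have long: "fisher_weight n (\<lambda>r. 2 * coord j r) r = 2 * (sinh (2 * r j))\<^sup>2" if "j \<in> {1..n}" for j
    using that root_coeff_long[of j n] by (simp add: fisher_weight_def coord_def)
  have diff: "fisher_weight n (\<lambda>r. coord j r - coord k r) r = 4 * (sinh (r j - r k))\<^sup>2" for j k
    using root_coeff_diff[of n j k] by (simp add: fisher_weight_def coord_def)
  have sum: "fisher_weight n (\<lambda>r. coord j r + coord k r) r = 4 * (sinh (r j + r k))\<^sup>2"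
    if "j < k" for j k
    using that root_coeff_sum[of j k n] by (simp add: fisher_weight_def coord_def)
  have sym: "(sinh (r j - r k))\<^sup>2 = (sinh (r k - r j))\<^sup>2" for j k
    by (simp add: sinh_sq_eq_iff)
  have "(\<forall>\<alpha>\<in>pos_roots n. w \<le> fisher_weight n \<alpha> r) \<longleftrightarrow> ?L \<and>
     (\<forall>j k. 1 \<le> j \<and> j < k \<and> k \<le> n \<longrightarrow>
       w \<le> 4 * (sinh (r j - r k))\<^sup>2 \<and> w \<le> 4 * (sinh (r j + r k))\<^sup>2)" (is "?A \<longleftrightarrow> ?L \<and> ?S'")
  proof (intro iffI conjI)
    assume A: ?A
    show ?L
    proof
      fix j assume "j \<in> {1..n}"
      moreover from this have "(\<lambda>r. 2 * coord j r) \<in> pos_roots n"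
        by (auto simp: pos_roots_def long_roots_def)
      ultimately show "w \<le> 2 * (sinh (2 * r j))\<^sup>2"
        using A long by metis
    qed
    show ?S'
    proof (intro allI impI)
      fix j k assume jk: "1 \<le> j \<and> j < k \<and> k \<le> n"
      then have "(\<lambda>r. coord j r - coord k r) \<in> pos_roots n"
        and "(\<lambda>r. coord j r + coord k r) \<in> pos_roots n"
        unfolding pos_roots_def by blast+
      then show "w \<le> 4 * (sinh (r j - r k))\<^sup>2 \<and> w \<le> 4 * (sinh (r j + r k))\<^sup>2"
        using A diff sum jk by metis
    qed
  next
    assume "?L \<and> ?S'"
    then show ?A
      by (auto simp: pos_roots_def long_roots_def long[simplified] diff sum)
  qed
  \<comment> \<open>Swapping the two indices changes only the sign of the difference, which the
    square ignores.\<close>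
  also have "?S' \<longleftrightarrow> ?S"
  proof
    assume S': ?S'
    show ?S
    proof (intro ballI impI)
      fix j k assume jk: "j \<in> {1..n}" "k \<in> {1..n}" "j \<noteq> k"
      then consider "j < k" | "k < j"
        by linarith
      then show "w \<le> 4 * (sinh (r j - r k))\<^sup>2 \<and> w \<le> 4 * (sinh (r j + r k))\<^sup>2"
      proof cases
        case 1
        then show ?thesis
          using S' jk by auto
      next
        case 2
        then have "w \<le> 4 * (sinh (r k - r j))\<^sup>2 \<and> w \<le> 4 * (sinh (r k + r j))\<^sup>2"
          using S' jk by auto
        then show ?thesis
          by (simp add: sym[of j k] add.commute)
      qed
    qed
  qed auto
  finally show ?thesis
    using ge by blast
qed

section \<open>Balanced arithmetic progressions and domination\<close>

lemma arith_prog_apply: "j \<in> {1..n} \<Longrightarrow> arith_prog n a b j = a + real (n - j) * b"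
  by (simp add: arith_prog_def)

lemma arith_prog_in_chamber: "a \<ge> 0 \<Longrightarrow> b \<ge> 0 \<Longrightarrow> arith_prog n a b \<in> chamber n"
  by (auto simp: chamber_def arith_prog_def intro!: mult_right_mono)

text \<open>All coordinates are at least \<open>a\<close> and any two are at least \<open>b\<close>
  apart, so no root falls below \<open>w\<close>; the long root at the smallest coordinate attains
  it.\<close>

lemma worst_weight_arith_prog:
  assumes "n \<ge> 1" "a > 0" "b > 0" "2 * (sinh (2 * a))\<^sup>2 = w" "4 * (sinh b)\<^sup>2 = w"
  shows "worst_weight n (arith_prog n a b) = w"
proof (rule antisym)
  let ?p = "arith_prog n a b"
  \<comment> \<open>The last coordinate of the progression is exactly \<open>a\<close>, so this
    bound is \<open>w\<close>.\<close>
  have "worst_weight n ?p \<le> 2 * (sinh (2 * ?p n))\<^sup>2"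
    using worst_weight_ge_iff[of n "worst_weight n ?p" ?p] assms(1) by auto
  then show "worst_weight n ?p \<le> w"
    using assms by (simp add: arith_prog_apply)
  have p: "?p j \<ge> a" if "j \<in> {1..n}" for j
    using that assms by (simp add: arith_prog_apply)
  have gap: "\<bar>?p j - ?p k\<bar> \<ge> b" if "j \<in> {1..n}" "k \<in> {1..n}" "j \<noteq> k" for j k
  proof -
    have "?p j - ?p k = (real k - real j) * b"
      using that by (simp add: arith_prog_apply of_nat_diff algebra_simps)
    moreover have "1 \<le> \<bar>real k - real j\<bar>"
      using that by linarith
    ultimately show ?thesis
      using assms(3) by (simp add: abs_mult)
  qed
  show "w \<le> worst_weight n ?p"
    unfolding worst_weight_ge_iff[OF assms(1)]
  proof (intro conjI ballI impI)
    fix j assume "j \<in> {1..n}"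
    then have "(sinh (2 * a))\<^sup>2 \<le> (sinh (2 * ?p j))\<^sup>2"
      unfolding sinh_sq_le_iff using p[of j] assms(2) by simp
    then show "w \<le> 2 * (sinh (2 * ?p j))\<^sup>2"
      using assms(4) by simp
  next
    fix j k assume jk: "j \<in> {1..n}" "k \<in> {1..n}" "j \<noteq> k"
    have "(sinh b)\<^sup>2 \<le> (sinh (?p j - ?p k))\<^sup>2"
      unfolding sinh_sq_le_iff using gap[OF jk] assms(3) by simp
    then show "w \<le> 4 * (sinh (?p j - ?p k))\<^sup>2"
      using assms(5) by simp
    \<comment> \<open>For positive coordinates the sum is at least the distance, so the gap bound
      covers sums too.\<close>
    have "(sinh b)\<^sup>2 \<le> (sinh (?p j + ?p k))\<^sup>2"
      unfolding sinh_sq_le_iff using gap[OF jk] p[OF jk(1)] p[OF jk(2)] assms(2,3) by simp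
    then show "w \<le> 4 * (sinh (?p j + ?p k))\<^sup>2"
      using assms(5) by simp
  qed
qed

text \<open>Only the simple roots enter: the long root at index \<open>n\<close> gives
  \<open>r n \<ge> a\<close>, and each neighbouring difference gives a gap of at least
  \<open>b\<close>. Adding up the gaps from the last coordinate yields the bound.\<close>

lemma chamber_ge_arith_prog:
  assumes "n \<ge> 1" "a > 0" "b > 0" "2 * (sinh (2 * a))\<^sup>2 = w" "4 * (sinh b)\<^sup>2 = w"
    and r: "r \<in> chamber n" "w \<le> worst_weight n r" and j: "j \<in> {1..n}"
  shows "arith_prog n a b j \<le> r j"
proof -
  have long: "w \<le> 2 * (sinh (2 * r n))\<^sup>2"
    and short: "\<And>j k. j \<in> {1..n} \<Longrightarrow> k \<in> {1..n} \<Longrightarrow> j \<noteq> k \<Longrightarrow> w \<le> 4 * (sinh (r j - r k))\<^sup>2"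
    using r(2) assms(1) unfolding worst_weight_ge_iff[OF assms(1)] by auto
  have "r j \<ge> a + real (n - j) * b" if "j \<le> n" "j \<ge> 1" for j
    using that
  \<comment> \<open>The induction runs downwards, with base case \<open>j = n\<close>. Nonnegativity
    and ordering in the chamber remove the absolute values.\<close>
  proof (induction j rule: inc_induct)
    case base
    have "(sinh (2 * a))\<^sup>2 \<le> (sinh (2 * r n))\<^sup>2"
      using long assms(4) by simp
    then show ?case
      unfolding sinh_sq_le_iff using assms(1,2) r(1) by (auto simp: chamber_def)
  next
    case (step j)
    have "(sinh b)\<^sup>2 \<le> (sinh (r j - r (Suc j)))\<^sup>2"
      using short[of j "Suc j"] step assms(5) by simp
    moreover have "r j \<ge> r (Suc j)"
      using r(1) step by (auto simp: chamber_def)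
    ultimately have "r j - r (Suc j) \<ge> b"
      unfolding sinh_sq_le_iff using assms(3) by simp
    moreover have "real (n - j) = real (n - Suc j) + 1"
      using step by (simp add: of_nat_diff)
    ultimately show ?case
      using step by (simp add: algebra_simps)
  qed
  then show ?thesis
    using j by (simp add: arith_prog_apply)
qed

section \<open>Photon number under coordinatewise domination\<close>

lemma photon_number_mono:
  assumes "\<And>j. j \<in> {1..n} \<Longrightarrow> 0 \<le> p j" "\<And>j. j \<in> {1..n} \<Longrightarrow> p j \<le> r j"
  shows "photon_number n p \<le> photon_number n r"
  unfolding photon_number_def by (rule sum_mono) (use assms in \<open>force simp: sinh_sq_le_iff\<close>)

text \<open>The termwise differences are nonnegative with sum zero, so each vanishes; on nonnegative
  arguments the squared \<open>sinh\<close> is injective.\<close>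

lemma photon_number_eqD:
  assumes "\<And>j. j \<in> {1..n} \<Longrightarrow> 0 \<le> p j" "\<And>j. j \<in> {1..n} \<Longrightarrow> p j \<le> r j"
    and "photon_number n p = photon_number n r" and "j \<in> {1..n}"
  shows "p j = r j"
proof -
  have le: "(sinh (p i))\<^sup>2 \<le> (sinh (r i))\<^sup>2" if "i \<in> {1..n}" for i
    unfolding sinh_sq_le_iff using assms(1,2)[OF that] by linarith
  have "(\<Sum>i=1..n. (sinh (r i))\<^sup>2 - (sinh (p i))\<^sup>2) = 0"
    using assms(3) by (simp add: photon_number_def sum_subtractf)
  then have "(sinh (p j))\<^sup>2 = (sinh (r j))\<^sup>2"
    using le assms(4) by (subst (asm) sum_nonneg_eq_0_iff) auto
  then show ?thesis
    unfolding sinh_sq_eq_iff using assms(1,2)[OF assms(4)] by linarith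
qed

lemma feasible_photon_number:
  assumes "n \<ge> 1" "a > 0" "b > 0" "2 * (sinh (2 * a))\<^sup>2 = w" "4 * (sinh b)\<^sup>2 = w"
    and r: "r \<in> chamber n" "w \<le> worst_weight n r"
  shows "photon_number n (arith_prog n a b) \<le> photon_number n r"
    and "photon_number n r = photon_number n (arith_prog n a b) \<Longrightarrow> r = arith_prog n a b"
proof -
  let ?p = "arith_prog n a b"
  have nonneg: "0 \<le> ?p j" if "j \<in> {1..n}" for j
    using that assms(2,3) by (simp add: arith_prog_apply)
  note le = chamber_ge_arith_prog[OF assms]
  show "photon_number n ?p \<le> photon_number n r"
    using nonneg le by (rule photon_number_mono)
  assume "photon_number n r = photon_number n ?p"
  then have "r j = ?p j" if "j \<in> {1..n}" for j
    using photon_number_eqD[of n ?p r j] nonneg le that by metis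
  moreover have "r \<in> vecs n" "?p \<in> vecs n"
    using r(1) by (auto simp: chamber_def arith_prog_def)
  \<comment> \<open>Agreement on the index set suffices because both vectors are
    extensional.\<close>
  ultimately show "r = ?p"
    by (meson PiE_ext)
qed

lemma is_arg_min_photon_number_iff:
  assumes "n \<ge> 1" "a > 0" "b > 0" "2 * (sinh (2 * a))\<^sup>2 = w" "4 * (sinh b)\<^sup>2 = w"
  shows "is_arg_min (photon_number n) (\<lambda>r. r \<in> chamber n \<and> worst_weight n r \<ge> w) r
    \<longleftrightarrow> r = arith_prog n a b"
proof -
  let ?p = "arith_prog n a b"
  have "?p \<in> chamber n" "w \<le> worst_weight n ?p"
    using assms by (simp_all add: arith_prog_in_chamber worst_weight_arith_prog)
  then show ?thesis
    using feasible_photon_number[OF assms] unfolding is_arg_min_def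
    by (meson antisym not_less)
qed

section \<open>Existence of balanced pairs\<close>

lemma sinh_sq_surj:
  assumes "c > 0" "w > 0"
  shows "\<exists>x>0. c * (sinh x)\<^sup>2 = (w::real)"
  using assms by (intro exI[of _ "arsinh (sqrt (w / c))"]) (auto)

text \<open>The intermediate value theorem, applied to the photon number as a function of
  \<open>a\<close> alone once \<open>b\<close> has been eliminated.\<close>

lemma exists_balanced_photon_number:
  assumes "n \<ge> 1" "N > 0"
  obtains a b where "a > 0" "b > 0" "2 * (sinh (2 * a))\<^sup>2 = 4 * (sinh b)\<^sup>2"
    "photon_number n (arith_prog n a b) = N"
proof -
  \<comment> \<open>This solves the balance condition for \<open>b\<close>:
    \<open>sinh b = sinh (2 * a) / sqrt 2\<close>.\<close>
  define b where "b = (\<lambda>a::real. arsinh (sinh (2 * a) / sqrt 2))"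
  define G where "G = (\<lambda>a. photon_number n (arith_prog n a (b a)))"
  have G: "G a = (\<Sum>j=1..n. (sinh (a + real (n - j) * b a))\<^sup>2)" for a
    unfolding G_def photon_number_def by (rule sum.cong) (auto simp: arith_prog_apply)
  \<comment> \<open>At \<open>a = c\<close> the last summand alone equals \<open>N\<close>, which
    makes \<open>c\<close> an upper end point.\<close>
  define c where "c = arsinh (sqrt N)"
  have "c \<ge> 0"
    unfolding c_def using assms by (intro less_imp_le) simp
  \<comment> \<open>For \<open>a = 0\<close> the step \<open>b 0\<close> is zero as well, so the
    whole progression vanishes and \<open>G 0 = 0\<close>. As \<open>N > 0\<close>, this also
    excludes \<open>a = 0\<close> below.\<close>
  have "G 0 \<le> N"
    using assms by (simp add: G b_def)
  moreover have "N \<le> G c"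
  proof -
    have "(sinh c)\<^sup>2 = N"
      using assms by (simp add: c_def)
    moreover have "(sinh (c + real (n - n) * b c))\<^sup>2 \<le> G c"
      unfolding G using assms by (intro member_le_sum) auto
    ultimately show ?thesis
      by simp
  qed
  moreover have "continuous_on {0..c} G"
    unfolding G b_def by (intro continuous_intros) auto
  ultimately obtain a where a: "0 \<le> a" "G a = N"
    using IVT'[of G 0 N c] \<open>c \<ge> 0\<close> by auto
  have "a \<noteq> 0"
    using a assms by (auto simp: G b_def)
  then have "a > 0"
    using a by simp
  moreover have "b a > 0"
    using \<open>a > 0\<close> by (simp add: b_def)
  moreover have "2 * (sinh (2 * a))\<^sup>2 = 4 * (sinh (b a))\<^sup>2"
    by (simp add: b_def power_divide)
  ultimately show thesis
    using that a unfolding G_def by blast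
qed

section \<open>Reduction of the full space to the chamber\<close>

lemma exists_permutes_antimono:
  fixes f :: "nat \<Rightarrow> real"
  obtains \<pi> where "\<pi> permutes {1..n}"
    "\<And>j k. 1 \<le> j \<Longrightarrow> j \<le> k \<Longrightarrow> k \<le> n \<Longrightarrow> f (\<pi> k) \<le> f (\<pi> j)"
proof -
  \<comment> \<open>The indices themselves are sorted; negating the key gives decreasing values of
    \<open>f\<close>.\<close>
  define xs where "xs = sort_key (\<lambda>j. - f j) [1..<Suc n]"
  have xs: "length xs = n" "distinct xs" "set xs = {1..n}" "sorted (map (\<lambda>j. - f j) xs)"
    by (auto simp: xs_def)
  \<comment> \<open>List positions start at 0 and coordinates at 1, hence the shift. Outside the
    index set the map is the identity, as \<open>permutes\<close> demands.\<close>
  define \<pi> where "\<pi> = (\<lambda>j. if j \<in> {1..n} then xs ! (j - 1) else j)"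
  have "bij_betw (\<lambda>j. j - 1) {1..n} {..<n}"
    by (rule bij_betw_byWitness[of _ Suc]) auto
  moreover have "bij_betw ((!) xs) {..<n} {1..n}"
    using bij_betw_nth xs by blast
  ultimately have "bij_betw ((!) xs \<circ> (\<lambda>j. j - 1)) {1..n} {1..n}"
    by (rule bij_betw_trans)
  then have "bij_betw \<pi> {1..n} {1..n}"
    by (rule bij_betw_cong[THEN iffD1, rotated]) (simp add: \<pi>_def)
  then have "\<pi> permutes {1..n}"
    by (rule bij_imp_permutes) (auto simp: \<pi>_def)
  moreover have "f (\<pi> k) \<le> f (\<pi> j)" if "1 \<le> j" "j \<le> k" "k \<le> n" for j k
    using sorted_nth_mono[OF xs(4), of "j - 1" "k - 1"] that xs(1) by (simp add: \<pi>_def)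
  ultimately show thesis
    by (rule that)
qed

text \<open>Permutations and sign changes only rearrange the roots up to sign. The inequality for
  the worst weight is enough for carrying optimality over from the chamber.\<close>

lemma exists_chamber_representative:
  assumes "n \<ge> 1"
  obtains \<pi> where "\<pi> permutes {1..n}" "(\<lambda>j\<in>{1..n}. \<bar>r (\<pi> j)\<bar>) \<in> chamber n"
    "photon_number n (\<lambda>j\<in>{1..n}. \<bar>r (\<pi> j)\<bar>) = photon_number n r"
    "worst_weight n r \<le> worst_weight n (\<lambda>j\<in>{1..n}. \<bar>r (\<pi> j)\<bar>)"
proof -
  obtain \<pi> where perm: "\<pi> permutes {1..n}"
    and mono: "\<And>j k. 1 \<le> j \<Longrightarrow> j \<le> k \<Longrightarrow> k \<le> n \<Longrightarrow> \<bar>r (\<pi> k)\<bar> \<le> \<bar>r (\<pi> j)\<bar>"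
    using exists_permutes_antimono[where f = "\<lambda>j. \<bar>r j\<bar>"] by blast
  let ?q = "\<lambda>j\<in>{1..n}. \<bar>r (\<pi> j)\<bar>"
  have "?q \<in> chamber n"
    using mono by (auto simp: chamber_def)
  moreover have "photon_number n ?q = photon_number n r"
    unfolding photon_number_def using sum.permute[OF perm, of "\<lambda>j. (sinh (r j))\<^sup>2"]
    by (simp add: sinh_abs_sq)
  moreover have "worst_weight n r \<le> worst_weight n ?q"
  proof -
    have long: "\<And>j. j \<in> {1..n} \<Longrightarrow> worst_weight n r \<le> 2 * (sinh (2 * r j))\<^sup>2"
      and short: "\<And>j k. j \<in> {1..n} \<Longrightarrow> k \<in> {1..n} \<Longrightarrow> j \<noteq> k \<Longrightarrow>
        worst_weight n r \<le> 4 * (sinh (r j - r k))\<^sup>2 \<and> worst_weight n r \<le> 4 * (sinh (r j + r k))\<^sup>2"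
      using worst_weight_ge_iff[OF assms, of "worst_weight n r" r] by auto
    show ?thesis
      unfolding worst_weight_ge_iff[OF assms]
    proof (intro conjI ballI impI)
      fix j assume j: "j \<in> {1..n}"
      have "(sinh (2 * \<bar>r (\<pi> j)\<bar>))\<^sup>2 = (sinh (2 * r (\<pi> j)))\<^sup>2"
        by (simp add: sinh_sq_eq_iff abs_mult)
      then show "worst_weight n r \<le> 2 * (sinh (2 * ?q j))\<^sup>2"
        using j long[of "\<pi> j"] permutes_in_image[OF perm, of j] by simp
    next
      fix j k assume jk: "j \<in> {1..n}" "k \<in> {1..n}" "j \<noteq> k"
      let ?x = "r (\<pi> j)" and ?y = "r (\<pi> k)"
      have short': "worst_weight n r \<le> 4 * (sinh (?x - ?y))\<^sup>2"
        "worst_weight n r \<le> 4 * (sinh (?x + ?y))\<^sup>2"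
        using short[of "\<pi> j" "\<pi> k"] jk permutes_in_image[OF perm] permutes_inj[OF perm]
        by (auto simp: inj_eq)
      \<comment> \<open>Up to sign, passing to absolute values either keeps the difference and the
        sum or exchanges them, according to whether the signs of \<open>?x\<close> and
        \<open>?y\<close> agree.\<close>
      have "\<bar>\<bar>?x\<bar> - \<bar>?y\<bar>\<bar> = \<bar>?x - ?y\<bar> \<or> \<bar>\<bar>?x\<bar> - \<bar>?y\<bar>\<bar> = \<bar>?x + ?y\<bar>"
        "\<bar>\<bar>?x\<bar> + \<bar>?y\<bar>\<bar> = \<bar>?x - ?y\<bar> \<or> \<bar>\<bar>?x\<bar> + \<bar>?y\<bar>\<bar> = \<bar>?x + ?y\<bar>"
        by linarith+
      then have "worst_weight n r \<le> 4 * (sinh (\<bar>?x\<bar> - \<bar>?y\<bar>))\<^sup>2"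
        "worst_weight n r \<le> 4 * (sinh (\<bar>?x\<bar> + \<bar>?y\<bar>))\<^sup>2"
        using short' unfolding sinh_sq_eq_iff[symmetric] by metis+
      then show "worst_weight n r \<le> 4 * (sinh (?q j - ?q k))\<^sup>2"
        "worst_weight n r \<le> 4 * (sinh (?q j + ?q k))\<^sup>2"
        using jk by simp_all
    qed
  qed
  ultimately show thesis
    using that perm by blast
qed

section \<open>Maximizers at fixed photon number, minimizers at fixed worst weight\<close>

theorem theoremS22:
  fixes n :: nat and N :: real
  assumes "n \<ge> 2" and "N > 0"
  shows "(\<exists>a>0. \<exists>b>0.
            (\<forall>r. is_arg_max (worst_weight n) (\<lambda>r. r \<in> chamber n \<and> photon_number n r = N) r
                 \<longleftrightarrow> r = arith_prog n a b)
          \<and> 2 * (sinh (2 * a))\<^sup>2 = worst_weight n (arith_prog n a b)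
          \<and> 4 * (sinh b)\<^sup>2 = worst_weight n (arith_prog n a b)
          \<and> is_arg_max (worst_weight n) (\<lambda>r. r \<in> vecs n \<and> photon_number n r = N) (arith_prog n a b)
          \<and> (\<forall>r. is_arg_max (worst_weight n) (\<lambda>r. r \<in> vecs n \<and> photon_number n r = N) r
                 \<longrightarrow> (\<exists>\<pi> s. \<pi> permutes {1..n} \<and> (\<forall>j\<in>{1..n}. s j = 1 \<or> s j = - 1)
                          \<and> (\<forall>j\<in>{1..n}. r j = s j * arith_prog n a b (\<pi> j)))))
       \<and> (\<forall>w\<^sub>0>0.
            (\<exists>a>0. \<exists>b>0. 2 * (sinh (2 * a))\<^sup>2 = w\<^sub>0 \<and> 4 * (sinh b)\<^sup>2 = w\<^sub>0)
          \<and> (\<forall>a>0. \<forall>b>0. 2 * (sinh (2 * a))\<^sup>2 = w\<^sub>0 \<and> 4 * (sinh b)\<^sup>2 = w\<^sub>0 \<longrightarrow>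
               (\<forall>r. is_arg_min (photon_number n) (\<lambda>r. r \<in> chamber n \<and> worst_weight n r \<ge> w\<^sub>0) r
                    \<longleftrightarrow> r = arith_prog n a b)))"
proof (intro conjI allI impI)
  have n: "n \<ge> 1"
    using assms by simp
  obtain a b where ab: "a > 0" "b > 0" "2 * (sinh (2 * a))\<^sup>2 = 4 * (sinh b)\<^sup>2"
    and photon: "photon_number n (arith_prog n a b) = N"
    using exists_balanced_photon_number[OF n assms(2)] by blast
  let ?p = "arith_prog n a b"
  define w where "w = 4 * (sinh b)\<^sup>2"
  have bal: "2 * (sinh (2 * a))\<^sup>2 = w" "4 * (sinh b)\<^sup>2 = w"
    using ab by (simp_all add: w_def)
  have wp: "worst_weight n ?p = w"
    using n ab(1,2) bal by (rule worst_weight_arith_prog)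
  have chamber: "?p \<in> chamber n"
    using ab by (simp add: arith_prog_in_chamber)
  then have vecs: "?p \<in> vecs n"
    by (simp add: chamber_def)
  \<comment> \<open>A competitor at least as good as \<open>?p\<close> is feasible for the weight
    \<open>w\<close> and has the minimal photon number \<open>N\<close>, so the equality case of the
    minimization applies.\<close>
  have unique: "r = ?p" if "r \<in> chamber n" "photon_number n r = N" "w \<le> worst_weight n r" for r
    using feasible_photon_number(2)[OF n ab(1,2) bal that(1,3)] that(2) photon by simp
  have unique_vecs: "\<exists>\<pi>. \<pi> permutes {1..n} \<and> (\<lambda>j\<in>{1..n}. \<bar>r (\<pi> j)\<bar>) = ?p \<and> worst_weight n r \<le> w"
    if "photon_number n r = N" "w \<le> worst_weight n r" for r
  proof -
    obtain \<pi> where \<pi>: "\<pi> permutes {1..n}" "(\<lambda>j\<in>{1..n}. \<bar>r (\<pi> j)\<bar>) \<in> chamber n"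
      "photon_number n (\<lambda>j\<in>{1..n}. \<bar>r (\<pi> j)\<bar>) = photon_number n r"
      "worst_weight n r \<le> worst_weight n (\<lambda>j\<in>{1..n}. \<bar>r (\<pi> j)\<bar>)"
      by (rule exists_chamber_representative[OF n])
    then have "(\<lambda>j\<in>{1..n}. \<bar>r (\<pi> j)\<bar>) = ?p"
      using that by (intro unique) auto
    then show ?thesis
      using \<pi> wp by auto
  qed
  \<comment> \<open>A maximizer does at least as well as \<open>?p\<close>, hence equals it; nothing
    can do strictly better, since it too would be \<open>?p\<close>.\<close>
  have max_chamber: "is_arg_max (worst_weight n) (\<lambda>r. r \<in> chamber n \<and> photon_number n r = N) r
      \<longleftrightarrow> r = ?p" for r
    using unique chamber photon wp unfolding is_arg_max_def
    by (metis linorder_not_less order.strict_implies_order)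
  have max_vecs: "is_arg_max (worst_weight n) (\<lambda>r. r \<in> vecs n \<and> photon_number n r = N) ?p"
    using unique_vecs vecs photon wp unfolding is_arg_max_def
    by (metis linorder_not_less order.strict_implies_order)
  have signed: "\<exists>\<pi> s. \<pi> permutes {1..n} \<and> (\<forall>j\<in>{1..n}. s j = 1 \<or> s j = - 1)
      \<and> (\<forall>j\<in>{1..n}. r j = s j * ?p (\<pi> j))"
    if r: "is_arg_max (worst_weight n) (\<lambda>r. r \<in> vecs n \<and> photon_number n r = N) r" for r
  proof -
    have "photon_number n r = N" "w \<le> worst_weight n r"
      using r vecs photon wp unfolding is_arg_max_def by (auto simp: not_less)
    then obtain \<pi> where \<pi>: "\<pi> permutes {1..n}" "(\<lambda>j\<in>{1..n}. \<bar>r (\<pi> j)\<bar>) = ?p"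
      using unique_vecs by blast
    \<comment> \<open>Sorting expresses \<open>?p\<close> through \<open>r\<close>; the inverse
      permutation expresses \<open>r\<close> through \<open>?p\<close>.\<close>
    have inv: "inv \<pi> permutes {1..n}"
      using \<pi>(1) by (rule permutes_inv)
    have "?p (inv \<pi> j) = \<bar>r j\<bar>" if "j \<in> {1..n}" for j
    proof -
      have "inv \<pi> j \<in> {1..n}"
        using permutes_in_image[OF inv] that by blast
      then show ?thesis
        unfolding \<pi>(2)[symmetric] by (simp add: permutes_inverses(1)[OF \<pi>(1)])
    qed
    then show ?thesis
      using inv by (intro exI[of _ "inv \<pi>"] exI[of _ "\<lambda>j. if r j \<ge> 0 then 1 else - 1"]) auto
  qed
  show "\<exists>a>0. \<exists>b>0.
            (\<forall>r. is_arg_max (worst_weight n) (\<lambda>r. r \<in> chamber n \<and> photon_number n r = N) r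
                 \<longleftrightarrow> r = arith_prog n a b)
          \<and> 2 * (sinh (2 * a))\<^sup>2 = worst_weight n (arith_prog n a b)
          \<and> 4 * (sinh b)\<^sup>2 = worst_weight n (arith_prog n a b)
          \<and> is_arg_max (worst_weight n) (\<lambda>r. r \<in> vecs n \<and> photon_number n r = N) (arith_prog n a b)
          \<and> (\<forall>r. is_arg_max (worst_weight n) (\<lambda>r. r \<in> vecs n \<and> photon_number n r = N) r
                 \<longrightarrow> (\<exists>\<pi> s. \<pi> permutes {1..n} \<and> (\<forall>j\<in>{1..n}. s j = 1 \<or> s j = - 1)
                          \<and> (\<forall>j\<in>{1..n}. r j = s j * arith_prog n a b (\<pi> j))))"
    using ab(1,2) max_chamber max_vecs signed bal unfolding wp[symmetric]
    by (intro exI[of _ a] exI[of _ b] conjI allI impI) assumption+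
next
  fix w\<^sub>0 :: real assume w: "w\<^sub>0 > 0"
  obtain x where "x > 0" "2 * (sinh x)\<^sup>2 = w\<^sub>0"
    using sinh_sq_surj[of 2] w by auto
  moreover obtain b where "b > 0" "4 * (sinh b)\<^sup>2 = w\<^sub>0"
    using sinh_sq_surj[of 4] w by auto
  \<comment> \<open>Here \<open>x\<close> plays the role of \<open>2 * a\<close>, hence the witness
    \<open>x / 2\<close>.\<close>
  ultimately show "\<exists>a>0. \<exists>b>0. 2 * (sinh (2 * a))\<^sup>2 = w\<^sub>0 \<and> 4 * (sinh b)\<^sup>2 = w\<^sub>0"
    by (intro exI[of _ "x / 2"] conjI exI[of _ b]) auto
next
  fix w\<^sub>0 a b :: real and r
  assume "a > 0" "b > 0" "2 * (sinh (2 * a))\<^sup>2 = w\<^sub>0 \<and> 4 * (sinh b)\<^sup>2 = w\<^sub>0"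
  then show "is_arg_min (photon_number n) (\<lambda>r. r \<in> chamber n \<and> worst_weight n r \<ge> w\<^sub>0) r
      \<longleftrightarrow> r = arith_prog n a b"
    using assms(1) by (intro is_arg_min_photon_number_iff) auto
qed

end
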